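(* Let $p\ge 0$ be an integer and let a one-dimensional CPR method be given by the nodal (Lagrange) basis of polynomials of degree $\le p$ at distinct nodes $z_0<\dots<z_p$ in $[-1,1]$ that are symmetric about $0$, associated with a quadrature rule with these nodes and positive weights $\omega_0,\dots,\omega_p>0$ which is exact on $[-1,1]$ for polynomials of degree $\le 2p-1$. Let $M=\mathrm{diag}(\omega_0,\dots,\omega_p)$, $B=\mathrm{diag}(-1,1)$, let $R$ be the restriction matrix (interpolation to the boundary points $-1,1$) and $D$ the derivative matrix, satisfying the SBP property $MD+D^TM=R^TBR$. Let $C\in\mathbb{R}^{(p+1)\times 2}$ be the correction matrix. Then: 1. If $\vec 1^{\,T}MC=\vec 1^{\,T}R^TB$, where $\vec 1=(1,\dots,1)^T$ represents the constant function $1$, then the CPR method with correction matrix $C$ is conservative. 2. If $C=(M+K)^{-1}R^TB$, where $K\in\mathbb{R}^{(p+1)\times(p+1)}$ is symmetric, $M+K$ is positive definite and $KD$ is antisymmetric, then the CPR method with correction matrix $C$ is linearly stable in the discrete norm $\|\cdot\|_{M+K}$. 3. If $C=(M+K)^{-1}R^TB$, where $K\in\mathbb{R}^{(p+1)\times(p+1)}$ is symmetric, $M+K$ is positive definite and $KD$ is antisymmetric, then the CPR method with correction matrix $C$ is associated with a flux reconstruction scheme using symmetric correction functions, i.e. the associated correction functions satisfy $g_L(\xi)=g_R(-\xi)$.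
   Context: Matrices. Let $\ell_0,\dots,\ell_p$ be the Lagrange polynomials of degree $\le p$ with $\ell_j(z_i)=\delta_{ij}$. A polynomial $u$ of degree $\le p$ is represented by $\vec u=(u(z_0),\dots,u(z_p))^T$. The derivative matrix is $D_{ij}=\ell_j'(z_i)$, so $D\vec u$ represents $u'$. The restriction matrix $R\in\mathbb{R}^{2\times(p+1)}$ has rows $(\ell_j(-1))_j$ and $(\ell_j(1))_j$, so $R\vec u=(u(-1),u(1))^T$. CPR method. Consider a scalar conservation law $\partial_t u+\partial_x f(u)=0$ on an interval divided into $N$ consecutive elements $i=1,\dots,N$ of widths $h_i>0$, with periodic boundary conditions (indices mod $N$). Each element is mapped affinely to the standard element $[-1,1]$, and its unknown is $\vec u^{\,i}(t)\in\mathbb{R}^{p+1}$. The semidiscretisation is $$\tfrac{h_i}{2}\,\partial_t\vec u^{\,i}+D\vec f^{\,i}+C\big(\vec f^{num,i}-R\vec f^{\,i}\big)=0,$$ where $\vec f^{\,i}=(f(u^i_0),\dots,f(u^i_p))^T$ and $\vec f^{num,i}=(f^{num}_{i-1/2},f^{num}_{i+1/2})^T$. Here $f^{num}_{i+1/2}=f^{num}(u_-,u_+)$ is a common numerical flux at the interface between elements $i$ and $i+1$, $u_-$ being the second component of $R\vec u^{\,i}$ and $u_+$ the first component of $R\vec u^{\,i+1}$. Conservative means: for every solution and each element, $\tfrac{h_i}{2}\frac{d}{dt}\vec 1^{\,T}M\vec u^{\,i}=-\big(f^{num}_{i+1/2}-f^{num}_{i-1/2}\big)$; consequently the total $\sum_i\tfrac{h_i}{2}\vec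 1^{\,T}M\vec u^{\,i}$ is constant in time for periodic boundary conditions. Linearly stable in $\|\cdot\|_{M+K}$ means: for the linear advection flux $f(u)=u$ and any numerical flux $f^{num}(u_-,u_+)=\frac{u_++u_-}{2}-\alpha(u_+-u_-)$ with $\alpha\ge 0$, every solution satisfies $\frac{d}{dt}\sum_i\tfrac{h_i}{2}\|\vec u^{\,i}\|_{M+K}^2\le 0$ (periodic boundary conditions), where $\|\vec u\|_{M+K}^2=\vec u^{\,T}(M+K)\vec u$. Associated flux reconstruction (FR) scheme: the correction functions $g_L,g_R$ associated with $C$ are the polynomials of degree $\le p+1$ determined by $g_L'(z_i)=C_{i,1}$, $g_R'(z_i)=C_{i,2}$ for $i=0,\dots,p$ (first and second column of $C$) and the normalisation $g_L(-1)=1=g_R(1)$. *)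

theory Defs
  imports "HOL-Analysis.Analysis" "HOL-Computational_Algebra.Polynomial"
begin

text \<open>
  Nodes are indexed by a finite linearly ordered type \<^typ>\<open>'n\<close> with \<open>p + 1\<close> elements, so that a
  polynomial of degree at most \<open>p\<close> is represented by a vector in \<open>real ^ 'n\<close>. An \<open>m \<times> n\<close> matrix
  has type \<open>real ^ 'n ^ 'm\<close>; the index type \<^typ>\<open>2\<close> has the elements \<open>1\<close> (left boundary)
  and \<open>2\<close> (right boundary).
\<close>

definition lagrange :: "('n::finite \<Rightarrow> real) \<Rightarrow> 'n \<Rightarrow> real poly" where
  "lagrange z j = (\<Prod>k\<in>UNIV - {j}. smult (1 / (z j - z k)) [:- z k, 1:])"

lemma poly_lagrange_node:
  assumes "inj z"
  shows "poly (lagrange z j) (z i) = (if i = j then 1 else 0)"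
proof (cases "i = j")
  case True
  have "poly (lagrange z j) (z j) = (\<Prod>k\<in>UNIV - {j}. 1)"
    unfolding lagrange_def poly_prod
  proof (rule prod.cong)
    fix k assume "k \<in> UNIV - {j}"
    then have "z j - z k \<noteq> 0" using assms by (auto simp: inj_eq)
    then show "poly (smult (1 / (z j - z k)) [:- z k, 1:]) (z j) = 1"
      by (simp add: diff_divide_distrib[symmetric])
  qed simp
  then show ?thesis using True by simp
next
  case False
  then show ?thesis
    unfolding lagrange_def poly_prod by (auto intro!: prod_zero bexI[of _ i])
qed

lemma degree_lagrange: "degree (lagrange z (j::'n::finite)) \<le> CARD('n) - 1"
proof -
  have "degree (lagrange z j)
      \<le> sum (degree \<circ> (\<lambda>k. smult (1 / (z j - z k)) [:- z k, 1:])) (UNIV - {j})"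
    unfolding lagrange_def by (rule degree_prod_sum_le) simp
  also have "\<dots> \<le> (\<Sum>k\<in>UNIV - {j}. 1)"
    by (intro sum_mono) simp
  also have "\<dots> = CARD('n) - 1" by (simp add: card_Diff_singleton)
  finally show ?thesis .
qed

definition deriv_mat :: "('n::finite \<Rightarrow> real) \<Rightarrow> real ^ 'n ^ 'n" where
  "deriv_mat z = (\<chi> i j. poly (pderiv (lagrange z j)) (z i))"

definition restr_mat :: "('n::finite \<Rightarrow> real) \<Rightarrow> real ^ 'n ^ 2" where
  "restr_mat z = (\<chi> i j. poly (lagrange z j) (if i = 1 then - 1 else 1))"

definition mass_mat :: "('n::finite \<Rightarrow> real) \<Rightarrow> real ^ 'n ^ 'n" where
  "mass_mat w = (\<chi> i j. if i = j then w i else 0)"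

definition bdry_mat :: "real ^ 2 ^ 2" where
  "bdry_mat = (\<chi> i j. if i = j then (if i = 1 then - 1 else 1) else 0)"

definition quadrature_exact :: "('n::finite \<Rightarrow> real) \<Rightarrow> ('n \<Rightarrow> real) \<Rightarrow> real poly \<Rightarrow> bool" where
  "quadrature_exact z w q \<longleftrightarrow>
     (\<Sum>i\<in>UNIV. w i * poly q (z i)) = integral {- 1..1} (poly q)"

definition pos_definite :: "real ^ 'n ^ 'n \<Rightarrow> bool" where
  "pos_definite A \<longleftrightarrow> transpose A = A \<and> (\<forall>v. v \<noteq> 0 \<longrightarrow> v \<bullet> (A *v v) > 0)"

text \<open>
  The \<open>N\<close> elements are numbered \<open>0, \<dots>, N - 1\<close>, and element \<open>Suc i mod N\<close> is the right neighbour of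
  element \<open>i\<close>. \<open>right_flux z fnum N U i\<close> is the numerical flux at the interface between
  element \<open>i\<close> and its right neighbour, \<open>left_flux z fnum N U i\<close> the one at the interface between
  element \<open>i\<close> and its left neighbour; \<open>U i\<close> is the nodal vector of element \<open>i\<close>.
\<close>

definition right_flux ::
  "('n::finite \<Rightarrow> real) \<Rightarrow> (real \<Rightarrow> real \<Rightarrow> real) \<Rightarrow> nat \<Rightarrow> (nat \<Rightarrow> real ^ 'n) \<Rightarrow> nat \<Rightarrow> real" where
  "right_flux z fnum N U i =
     fnum ((restr_mat z *v U i) $ 2) ((restr_mat z *v U (Suc i mod N)) $ 1)"

definition left_flux ::
  "('n::finite \<Rightarrow> real) \<Rightarrow> (real \<Rightarrow> real \<Rightarrow> real) \<Rightarrow> nat \<Rightarrow> (nat \<Rightarrow> real ^ 'n) \<Rightarrow> nat \<Rightarrow> real" where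
  "left_flux z fnum N U i = right_flux z fnum N U ((i + N - 1) mod N)"

definition cpr_residual ::
  "('n::finite \<Rightarrow> real) \<Rightarrow> real ^ 2 ^ 'n \<Rightarrow> (real \<Rightarrow> real) \<Rightarrow> (real \<Rightarrow> real \<Rightarrow> real) \<Rightarrow> nat \<Rightarrow>
   (nat \<Rightarrow> real ^ 'n) \<Rightarrow> nat \<Rightarrow> real ^ 'n" where
  "cpr_residual z C f fnum N U i =
     (let fU = (\<chi> k. f (U i $ k));
          fbdry = vector [left_flux z fnum N U i, right_flux z fnum N U i]
      in deriv_mat z *v fU + C *v (fbdry - restr_mat z *v fU))"

text \<open>
  \<open>u i t\<close> is the nodal vector of element \<open>i\<close> at time \<open>t\<close>. The time set \<open>T\<close> may be any interval;
  at an end point belonging to \<open>T\<close> the time derivative is one-sided.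
\<close>

definition cpr_solution ::
  "('n::finite \<Rightarrow> real) \<Rightarrow> real ^ 2 ^ 'n \<Rightarrow> (real \<Rightarrow> real) \<Rightarrow> (real \<Rightarrow> real \<Rightarrow> real) \<Rightarrow>
   nat \<Rightarrow> (nat \<Rightarrow> real) \<Rightarrow> real set \<Rightarrow> (nat \<Rightarrow> real \<Rightarrow> real ^ 'n) \<Rightarrow> bool" where
  "cpr_solution z C f fnum N h T u \<longleftrightarrow>
     N \<ge> 1 \<and> (\<forall>i<N. h i > 0) \<and> is_interval T \<and>
     (\<forall>i<N. \<forall>t\<in>T. \<exists>u'. (u i has_vector_derivative u') (at t within T) \<and>
        (h i / 2) *\<^sub>R u' + cpr_residual z C f fnum N (\<lambda>k. u k t) i = 0)"

definition cpr_conservative ::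
  "('n::finite \<Rightarrow> real) \<Rightarrow> ('n \<Rightarrow> real) \<Rightarrow> real ^ 2 ^ 'n \<Rightarrow> bool" where
  "cpr_conservative z w C \<longleftrightarrow>
     (\<forall>f fnum N h T u. cpr_solution z C f fnum N h T u \<longrightarrow>
        (\<forall>i<N. \<forall>t\<in>T.
           ((\<lambda>s. h i / 2 * (1 \<bullet> (mass_mat w *v u i s))) has_real_derivative
             - (right_flux z fnum N (\<lambda>k. u k t) i - left_flux z fnum N (\<lambda>k. u k t) i))
           (at t within T)))"

lemma sum_left_flux: "(\<Sum>i<N. left_flux z fnum N U i) = (\<Sum>i<N. right_flux z fnum N U i)"
proof (cases N)
  case (Suc n)
  have "(\<Sum>i<N. left_flux z fnum N U i) =
      left_flux z fnum N U 0 + (\<Sum>i<n. left_flux z fnum N U (Suc i))"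
    unfolding Suc by (rule sum.lessThan_Suc_shift)
  also have "\<dots> = right_flux z fnum N U n + (\<Sum>i<n. right_flux z fnum N U i)"
  proof -
    have "(Suc i + Suc n - 1) mod Suc n = i" if "i < n" for i
    proof -
      have "Suc i + Suc n - 1 = i + Suc n" by simp
      then show ?thesis using that by (simp only: mod_add_self2) simp
    qed
    then have "(\<Sum>i<n. left_flux z fnum N U (Suc i)) = (\<Sum>i<n. right_flux z fnum N U i)"
      by (intro sum.cong) (simp_all only: left_flux_def Suc lessThan_iff)
    then show ?thesis by (simp add: left_flux_def Suc)
  qed
  finally show ?thesis using Suc by simp
qed simp

text \<open>For a conservative method the total amount of the conserved quantity is constant.\<close>

lemma cpr_conservative_total:
  assumes cons: "cpr_conservative z w C" and sol: "cpr_solution z C f fnum N h T u"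
  shows "(\<lambda>t. \<Sum>i<N. h i / 2 * (1 \<bullet> (mass_mat w *v u i t))) constant_on T"
proof -
  have "((\<lambda>t. \<Sum>i<N. h i / 2 * (1 \<bullet> (mass_mat w *v u i t))) has_real_derivative 0) (at t within T)"
    if "t \<in> T" for t
  proof -
    have "((\<lambda>s. \<Sum>i<N. h i / 2 * (1 \<bullet> (mass_mat w *v u i s))) has_real_derivative
        (\<Sum>i<N. - (right_flux z fnum N (\<lambda>k. u k t) i - left_flux z fnum N (\<lambda>k. u k t) i)))
        (at t within T)"
      using cons sol that unfolding cpr_conservative_def by (intro DERIV_sum) blast
    then show ?thesis by (simp add: sum_subtractf sum_left_flux)
  qed
  moreover have "convex T"
    using sol by (simp add: cpr_solution_def is_interval_convex_1)
  ultimately show ?thesis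
    unfolding constant_on_def by (intro has_field_derivative_zero_constant)
qed

text \<open>\<open>G\<close> is the Gram matrix of the norm in question.\<close>

definition cpr_linearly_stable ::
  "('n::finite \<Rightarrow> real) \<Rightarrow> real ^ 2 ^ 'n \<Rightarrow> real ^ 'n ^ 'n \<Rightarrow> bool" where
  "cpr_linearly_stable z C G \<longleftrightarrow>
     (\<forall>\<alpha>\<ge>0. \<forall>N h T u.
        cpr_solution z C (\<lambda>x. x) (\<lambda>um up. (up + um) / 2 - \<alpha> * (up - um)) N h T u \<longrightarrow>
        (\<forall>t\<in>T. \<exists>d\<le>0.
           ((\<lambda>s. \<Sum>i<N. h i / 2 * (u i s \<bullet> (G *v u i s))) has_real_derivative d)
           (at t within T)))"

definition left_correction :: "('n::finite \<Rightarrow> real) \<Rightarrow> real ^ 2 ^ 'n \<Rightarrow> real poly \<Rightarrow> bool" where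
  "left_correction z C g \<longleftrightarrow>
     degree g \<le> CARD('n) \<and> (\<forall>i. poly (pderiv g) (z i) = C $ i $ 1) \<and> poly g (- 1) = 1"

definition right_correction :: "('n::finite \<Rightarrow> real) \<Rightarrow> real ^ 2 ^ 'n \<Rightarrow> real poly \<Rightarrow> bool" where
  "right_correction z C g \<longleftrightarrow>
     degree g \<le> CARD('n) \<and> (\<forall>i. poly (pderiv g) (z i) = C $ i $ 2) \<and> poly g 1 = 1"

definition symmetric_FR :: "('n::finite \<Rightarrow> real) \<Rightarrow> real ^ 2 ^ 'n \<Rightarrow> bool" where
  "symmetric_FR z C \<longleftrightarrow>
     (\<exists>!g. left_correction z C g) \<and> (\<exists>!g. right_correction z C g) \<and>
     (\<forall>gL gR. left_correction z C gL \<longrightarrow> right_correction z C gR \<longrightarrow>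
        (\<forall>\<xi>. poly gL \<xi> = poly gR (- \<xi>)))"

end

theory Submission
  imports Defs
begin

text \<open>
  Conservation and stability follow by pairing the scheme with \<open>M 1\<close> and \<open>(M + K) u\<close> and using
  summation by parts: \<open>K D\<close> is antisymmetric and drops out of the energy rate, and the interface with
  jump \<open>u\<^sub>+ - u\<^sub>-\<close> contributes \<open>- 2 \<alpha> (u\<^sub>+ - u\<^sub>-)\<^sup>2\<close> to it.

  For the symmetry of the correction functions, it suffices that \<open>M + K\<close> commutes with the
  reflection \<open>x \<mapsto> - x\<close> of the nodes, since \<open>R\<^sup>T B\<close> changes sign under reflection combined with swapping
  columns. The weights are symmetric because the quadrature is interpolatory. The form of \<open>K\<close> on
  polynomials satisfies \<open>K(f, g') = - K(f', g)\<close>, which together with symmetry forces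
  \<open>K(x\<^sup>m, x\<^sup>n) = 0\<close> for odd \<open>m + n\<close>; hence it is invariant under reflection.
\<close>

section \<open>Nodal vectors and Lagrange interpolation\<close>

definition nodal :: "('n::finite \<Rightarrow> real) \<Rightarrow> real poly \<Rightarrow> real ^ 'n" where
  "nodal z f = (\<chi> i. poly f (z i))"

lemma nodal_component [simp]: "nodal z f $ i = poly f (z i)"
  by (simp add: nodal_def)

lemma poly_eqI_nodes:
  fixes z :: "'n::finite \<Rightarrow> real"
  assumes "inj z" "degree f < CARD('n)" "degree g < CARD('n)"
    and "\<And>i. poly f (z i) = poly g (z i)"
  shows "f = g"
  by (rule poly_eqI_degree[where A = "range z"]) (use assms in \<open>auto simp: card_image\<close>)

lemma degree_lagrange_less: "degree (lagrange z (j::'n::finite)) < CARD('n)"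
  using degree_lagrange[of z j] by (metis One_nat_def Suc_pred le_imp_less_Suc zero_less_card_finite)

lemma degree_lagrange_sum:
  "degree (\<Sum>j\<in>UNIV. smult (c j) (lagrange z (j::'n::finite))) < CARD('n)"
proof -
  have "degree (\<Sum>j\<in>UNIV. smult (c j) (lagrange z j)) \<le> CARD('n) - 1"
    by (rule degree_sum_le) (simp, rule order_trans[OF degree_smult_le degree_lagrange])
  then show ?thesis
    using zero_less_card_finite[where 'a = 'n] by linarith
qed

lemma poly_lagrange_sum:
  assumes "inj z"
  shows "poly (\<Sum>j\<in>UNIV. smult (c j) (lagrange z j)) (z i) = c i"
  by (simp add: poly_sum poly_lagrange_node[OF assms] if_distrib sum.delta cong: if_cong)

lemma lagrange_interpolation:
  fixes z :: "'n::finite \<Rightarrow> real"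
  assumes "inj z" "degree f < CARD('n)"
  shows "(\<Sum>j\<in>UNIV. smult (poly f (z j)) (lagrange z j)) = f"
  by (rule poly_eqI_nodes[OF assms(1) degree_lagrange_sum assms(2)])
    (simp add: poly_lagrange_sum[OF assms(1)])

lemma pderiv_sum_finite: "pderiv (sum f A) = (\<Sum>x\<in>A. pderiv (f x))"
  by (induction A rule: infinite_finite_induct) (simp_all add: pderiv_add)

text \<open>Below degree \<open>CARD('n)\<close> interpolation reproduces \<open>f\<close>, so
  differentiating the Lagrange expansion termwise produces the columns of
  \<open>deriv_mat\<close>.\<close>

lemma deriv_mat_nodal:
  fixes z :: "'n::finite \<Rightarrow> real"
  assumes "inj z" "degree f < CARD('n)"
  shows "deriv_mat z *v nodal z f = nodal z (pderiv f)"
proof -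
  have "pderiv f = (\<Sum>j\<in>UNIV. smult (poly f (z j)) (pderiv (lagrange z j)))"
    by (subst (1) lagrange_interpolation[OF assms, symmetric])
      (simp add: pderiv_sum_finite pderiv_smult)
  then show ?thesis
    by (simp add: vec_eq_iff deriv_mat_def matrix_vector_mult_def poly_sum mult.commute)
qed

lemma restr_mat_nodal:
  fixes z :: "'n::finite \<Rightarrow> real"
  assumes "inj z" "degree f < CARD('n)"
  shows "(restr_mat z *v nodal z f) $ i = poly f (if i = 1 then - 1 else 1)"
proof -
  have "poly f x = (\<Sum>j\<in>UNIV. poly f (z j) * poly (lagrange z j) x)" for x
    by (subst (1) lagrange_interpolation[OF assms, symmetric]) (simp add: poly_sum)
  from this[of "if i = 1 then - 1 else 1"] show ?thesis
    by (simp add: restr_mat_def matrix_vector_mult_def mult.commute)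
qed

lemma nodal_one: "nodal z 1 = 1"
  by (simp add: vec_eq_iff)

lemma deriv_mat_one: "inj z \<Longrightarrow> deriv_mat z *v 1 = 0"
  using deriv_mat_nodal[of z 1] by (simp add: nodal_one) (simp add: vec_eq_iff pderiv_1)

lemma restr_mat_one: "inj z \<Longrightarrow> restr_mat z *v 1 = 1"
  using restr_mat_nodal[of z 1] by (simp add: nodal_one vec_eq_iff)

section \<open>Inner products, summation by parts and positive definiteness\<close>

lemma inner_matrix_transpose:
  fixes A :: "real ^ 'n::finite ^ 'm::finite"
  shows "x \<bullet> (transpose A *v y) = (A *v x) \<bullet> y"
  by (metis dot_lmul_matrix inner_commute transpose_matrix_vector)

lemma inner_symmetric_matrix:
  fixes A :: "real ^ 'n::finite ^ 'n"
  assumes "transpose A = A"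
  shows "x \<bullet> (A *v y) = (A *v x) \<bullet> y"
  by (metis assms inner_matrix_transpose)

lemma transpose_mass_mat: "transpose (mass_mat w) = mass_mat w"
  by (auto simp: vec_eq_iff transpose_def mass_mat_def)

lemma bdry_mat_mult: "bdry_mat *v y = vector [- (y $ 1), y $ 2]"
  by (simp add: vec_eq_iff bdry_mat_def matrix_vector_mult_def sum_2 forall_2)

lemma inner_bdry_mat: "x \<bullet> (bdry_mat *v y) = x $ 2 * y $ 2 - x $ 1 * y $ 1"
  by (simp add: bdry_mat_mult inner_vec_def sum_2)

text \<open>Discrete integration by parts: for the interpolating polynomials the right-hand side is
  \<open>x(1) y(1) - x(-1) y(-1)\<close>.\<close>

lemma SBP_inner:
  assumes "mass_mat w ** deriv_mat z + transpose (deriv_mat z) ** mass_mat w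
      = transpose (restr_mat z) ** bdry_mat ** restr_mat z"
  shows "x \<bullet> (mass_mat w *v (deriv_mat z *v y)) + (deriv_mat z *v x) \<bullet> (mass_mat w *v y)
    = (restr_mat z *v x) \<bullet> (bdry_mat *v (restr_mat z *v y))"
proof -
  have "x \<bullet> ((mass_mat w ** deriv_mat z + transpose (deriv_mat z) ** mass_mat w) *v y)
      = x \<bullet> ((transpose (restr_mat z) ** bdry_mat ** restr_mat z) *v y)"
    using assms by simp
  then show ?thesis
    by (simp add: matrix_vector_mult_add_rdistrib inner_add_right inner_matrix_transpose
        flip: matrix_vector_mul_assoc del: transpose_matrix_vector)
qed

text \<open>Integration by parts for the form of \<open>K\<close>, without boundary term:
  antisymmetry of \<open>K D\<close> supplies the sign, symmetry of \<open>K\<close> moves it back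
  to the other side.\<close>

lemma skew_form:
  fixes K D :: "real ^ 'n::finite ^ 'n"
  assumes "transpose K = K" "transpose (K ** D) = - (K ** D)"
  shows "x \<bullet> (K *v (D *v y)) = - ((D *v x) \<bullet> (K *v y))"
proof -
  have "x \<bullet> ((K ** D) *v y) = - (x \<bullet> (transpose (K ** D) *v y))"
    unfolding assms(2)
    by (simp add: inner_vec_def matrix_vector_mult_def uminus_vec_def sum_negf)
  also have "\<dots> = - ((K *v (D *v x)) \<bullet> y)"
    unfolding inner_matrix_transpose by (simp add: matrix_vector_mul_assoc)
  also have "\<dots> = - ((D *v x) \<bullet> (K *v y))"
    by (simp add: inner_symmetric_matrix[OF assms(1)])
  finally show ?thesis
    by (simp add: matrix_vector_mul_assoc)
qed

lemma pos_definite_ker: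
  assumes "pos_definite G" "G *v x = 0"
  shows "x = 0"
  using assms unfolding pos_definite_def by (metis inner_zero_right less_irrefl)

text \<open>\<open>matrix_inv\<close> is defined by choice, so an inverse has to be exhibited: the
  trivial kernel gives a left inverse, which is two-sided for a square matrix.\<close>

lemma pos_definite_matrix_inv:
  assumes "pos_definite G"
  shows "G ** matrix_inv G = mat 1"
proof -
  obtain H where H: "H ** G = mat 1"
    using pos_definite_ker[OF assms] matrix_left_invertible_ker[of G] by blast
  then have "G ** H = mat 1"
    by (simp add: matrix_left_right_inverse)
  then have "\<exists>H. G ** H = mat 1 \<and> H ** G = mat 1"
    using H by blast
  then show ?thesis
    unfolding matrix_inv_def by (rule someI2_ex) blast
qed

text \<open>Stability and symmetry use the form of \<open>C\<close> only through this inverse-free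
  equation.\<close>

lemma pos_definite_mult_correction:
  assumes "pos_definite G" "C = matrix_inv G ** transpose (restr_mat z) ** bdry_mat"
  shows "G ** C = transpose (restr_mat z) ** bdry_mat"
  by (simp add: assms(2) matrix_mul_assoc pos_definite_matrix_inv[OF assms(1)])

section \<open>Conservation and stability\<close>

lemma left_flux_Suc_mod:
  assumes "i < N"
  shows "left_flux z fnum N U (Suc i mod N) = right_flux z fnum N U i"
proof (cases "Suc i < N")
  case True
  then have "Suc i mod N + N - 1 = i + N" by simp
  then show ?thesis using assms by (simp add: left_flux_def)
next
  case False
  \<comment> \<open>Periodic wrap: the right neighbour is element 0, whose left neighbour is
    \<open>N - 1 = i\<close>.\<close>
  then have "N = Suc i" using assms by simp
  then show ?thesis by (simp add: left_flux_def)
qed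

text \<open>Cyclic shift of the elements, used to collect both contributions at an interface in one
  summand.\<close>

lemma sum_Suc_mod:
  fixes a :: "nat \<Rightarrow> 'a::comm_monoid_add"
  shows "(\<Sum>i<N. a (Suc i mod N)) = (\<Sum>i<N. a i)"
proof (cases N)
  case (Suc n)
  have "(\<Sum>i<n. a (Suc i mod Suc n)) = (\<Sum>i<n. a (Suc i))"
    by (intro sum.cong) auto
  then show ?thesis
    unfolding Suc sum.lessThan_Suc_shift[of a n] by (simp add: add.commute)
qed simp

lemma cpr_conservativeI:
  fixes z w :: "'n::finite \<Rightarrow> real"
  assumes inj: "inj z"
    and SBP: "mass_mat w ** deriv_mat z + transpose (deriv_mat z) ** mass_mat w
      = transpose (restr_mat z) ** bdry_mat ** restr_mat z"
    and C: "1 v* (mass_mat w ** C) = 1 v* (transpose (restr_mat z) ** bdry_mat)"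
  shows "cpr_conservative z w C"
  unfolding cpr_conservative_def
proof (intro allI impI ballI)
  fix f fnum N h T and u :: "nat \<Rightarrow> real \<Rightarrow> real ^ 'n" and i t
  assume sol: "cpr_solution z C f fnum N h T u" and i: "i < N" and t: "t \<in> T"
  let ?M = "mass_mat w" and ?R = "restr_mat z"
  let ?F = "vector [left_flux z fnum N (\<lambda>k. u k t) i, right_flux z fnum N (\<lambda>k. u k t) i] :: real ^ 2"
  define fU where "fU = (\<chi> k. f (u i t $ k))"
  obtain u' where u': "(u i has_vector_derivative u') (at t within T)"
    and "(h i / 2) *\<^sub>R u' + cpr_residual z C f fnum N (\<lambda>k. u k t) i = 0"
    using sol i t unfolding cpr_solution_def by blast
  then have eq: "(h i / 2) *\<^sub>R u' = - (deriv_mat z *v fU + C *v (?F - ?R *v fU))"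
    by (simp add: cpr_residual_def Let_def fU_def eq_neg_iff_add_eq_0
        del: minus_add_distrib)
  \<comment> \<open>\<open>D 1 = 0\<close> removes one of the two volume terms, and
    \<open>R 1 = 1\<close> leaves the boundary difference of the interpolated flux.\<close>
  have flux: "1 \<bullet> (?M *v (deriv_mat z *v fU)) = (?R *v fU) $ 2 - (?R *v fU) $ 1"
    using SBP_inner[OF SBP, of 1 fU]
    by (simp add: deriv_mat_one[OF inj] restr_mat_one[OF inj] inner_bdry_mat)
  \<comment> \<open>The hypothesis on \<open>C\<close> enters here: paired with \<open>1\<close>,
    \<open>M C\<close> acts as \<open>R^T B\<close>.\<close>
  have corr: "1 \<bullet> (?M *v (C *v x)) = x $ 2 - x $ 1" for x
  proof -
    have "1 \<bullet> (?M *v (C *v x)) = (1 v* (?M ** C)) \<bullet> x"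
      by (simp add: dot_lmul_matrix matrix_vector_mul_assoc)
    also have "\<dots> = 1 \<bullet> (transpose ?R *v (bdry_mat *v x))"
      unfolding C by (simp add: dot_lmul_matrix matrix_vector_mul_assoc del: transpose_matrix_vector)
    finally show ?thesis
      by (simp add: inner_matrix_transpose restr_mat_one[OF inj] inner_bdry_mat
          del: transpose_matrix_vector)
  qed
  have "h i / 2 * (1 \<bullet> (?M *v u')) = 1 \<bullet> (?M *v ((h i / 2) *\<^sub>R u'))"
    by (simp add: matrix_vector_mult_scaleR)
  also have "\<dots> = - (1 \<bullet> (?M *v (deriv_mat z *v fU)) + 1 \<bullet> (?M *v (C *v (?F - ?R *v fU))))"
    unfolding eq by (simp add: linear_neg[OF matrix_vector_mul_linear] matrix_vector_right_distrib
        inner_add_right del: minus_add_distrib)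
  \<comment> \<open>The boundary values of the interpolated flux cancel between the volume and
    correction terms.\<close>
  also have "\<dots> = - (right_flux z fnum N (\<lambda>k. u k t) i - left_flux z fnum N (\<lambda>k. u k t) i)"
    by (simp add: flux corr)
  finally have val: "h i / 2 * (1 \<bullet> (?M *v u')) =
      - (right_flux z fnum N (\<lambda>k. u k t) i - left_flux z fnum N (\<lambda>k. u k t) i)" .
  have "bounded_linear (\<lambda>v. h i / 2 * (1 \<bullet> (?M *v v)))"
    by (intro bounded_linear_intros matrix_vector_mul_bounded_linear)
  from bounded_linear.has_vector_derivative[OF this u']
  show "((\<lambda>s. h i / 2 * (1 \<bullet> (?M *v u i s))) has_real_derivative
      - (right_flux z fnum N (\<lambda>k. u k t) i - left_flux z fnum N (\<lambda>k. u k t) i)) (at t within T)"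
    unfolding has_real_derivative_iff_has_vector_derivative val .
qed

lemma cpr_linearly_stableI:
  fixes z w :: "'n::finite \<Rightarrow> real"
  assumes SBP: "mass_mat w ** deriv_mat z + transpose (deriv_mat z) ** mass_mat w
      = transpose (restr_mat z) ** bdry_mat ** restr_mat z"
    and K: "transpose K = K" "transpose (K ** deriv_mat z) = - (K ** deriv_mat z)"
    and C: "(mass_mat w + K) ** C = transpose (restr_mat z) ** bdry_mat"
  shows "cpr_linearly_stable z C (mass_mat w + K)"
  unfolding cpr_linearly_stable_def
proof (intro allI impI ballI)
  fix \<alpha> :: real and N h T and u :: "nat \<Rightarrow> real \<Rightarrow> real ^ 'n" and t
  let ?fnum = "\<lambda>um up. (up + um) / 2 - \<alpha> * (up - um)"
  assume \<alpha>: "0 \<le> \<alpha>" and sol: "cpr_solution z C (\<lambda>x. x) ?fnum N h T u" and t: "t \<in> T"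
  let ?M = "mass_mat w" and ?R = "restr_mat z" and ?D = "deriv_mat z"
  let ?G = "?M + K"
  define a where "a i = (?R *v u i t) $ 1" for i
  define b where "b i = (?R *v u i t) $ 2" for i
  define l where "l i = left_flux z ?fnum N (\<lambda>k. u k t) i" for i
  define r where "r i = right_flux z ?fnum N (\<lambda>k. u k t) i" for i
  \<comment> \<open>The energy rate of element \<open>i\<close>: the volume term gives
    \<open>- (b^2 - a^2)\<close>, the correction term
    \<open>- 2 (b (r - b) - a (l - a))\<close>.\<close>
  define d where "d i = (b i)\<^sup>2 - (a i)\<^sup>2 - 2 * (b i * r i - a i * l i)" for i
  have symG: "transpose ?G = ?G"
    using K(1) transpose_mass_mat[of w] by (simp add: transpose_def vec_eq_iff)
  \<comment> \<open>The \<open>K\<close> part equals its own negative; the \<open>M\<close> part is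
    half the boundary term of summation by parts.\<close>
  have skewG: "x \<bullet> (?G *v (?D *v x)) = (((?R *v x) $ 2)\<^sup>2 - ((?R *v x) $ 1)\<^sup>2) / 2" for x
  proof -
    have "x \<bullet> (K *v (?D *v x)) = 0"
      using skew_form[OF K, of x x] inner_symmetric_matrix[OF K(1), of x "?D *v x"]
      by (simp add: inner_commute)
    moreover have "(?D *v x) \<bullet> (?M *v x) = x \<bullet> (?M *v (?D *v x))"
      by (simp add: inner_symmetric_matrix[OF transpose_mass_mat, of x] inner_commute)
    ultimately show ?thesis
      using SBP_inner[OF SBP, of x x]
      by (simp add: matrix_vector_mult_add_rdistrib inner_add_right inner_bdry_mat power2_eq_square)
  qed
  have energy: "((\<lambda>s. h i / 2 * (u i s \<bullet> (?G *v u i s))) has_real_derivative d i) (at t within T)"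
    if i: "i < N" for i
  proof -
    let ?F = "vector [l i, r i] :: real ^ 2"
    obtain u' where u': "(u i has_vector_derivative u') (at t within T)"
      and "(h i / 2) *\<^sub>R u' + cpr_residual z C (\<lambda>x. x) ?fnum N (\<lambda>k. u k t) i = 0"
      using sol i t unfolding cpr_solution_def by blast
    then have eq: "(h i / 2) *\<^sub>R u' = - (?D *v u i t + C *v (?F - ?R *v u i t))"
      by (simp add: cpr_residual_def Let_def l_def r_def eq_neg_iff_add_eq_0
        del: minus_add_distrib)
    have corr: "x \<bullet> (?G *v (C *v y)) = (?R *v x) $ 2 * y $ 2 - (?R *v x) $ 1 * y $ 1" for x y
    proof -
      have "x \<bullet> (?G *v (C *v y)) = x \<bullet> (transpose ?R *v (bdry_mat *v y))"
        by (simp add: matrix_vector_mul_assoc C del: transpose_matrix_vector)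
      then show ?thesis
        by (simp add: inner_matrix_transpose inner_bdry_mat del: transpose_matrix_vector)
    qed
    \<comment> \<open>Symmetry of \<open>M + K\<close> merges the two product-rule terms; moving
      \<open>h i / 2\<close> inside allows the scheme to be substituted.\<close>
    have "h i / 2 * (u i t \<bullet> (?G *v u') + u' \<bullet> (?G *v u i t))
        = 2 * (u i t \<bullet> (?G *v ((h i / 2) *\<^sub>R u')))"
      by (simp add: matrix_vector_mult_scaleR inner_symmetric_matrix[OF symG, of "u i t"]
          inner_commute)
    also have "\<dots> = - 2 * (u i t \<bullet> (?G *v (?D *v u i t))
        + u i t \<bullet> (?G *v (C *v (?F - ?R *v u i t))))"
      unfolding eq by (simp add: linear_neg[OF matrix_vector_mul_linear]
          matrix_vector_right_distrib inner_add_right del: minus_add_distrib)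
    also have "\<dots> = d i"
      unfolding skewG corr by (simp add: d_def a_def b_def power2_eq_square field_simps)
    finally have val: "h i / 2 * (u i t \<bullet> (?G *v u') + u' \<bullet> (?G *v u i t)) = d i" .
    have "((\<lambda>s. ?G *v u i s) has_vector_derivative ?G *v u') (at t within T)"
      by (rule bounded_linear.has_vector_derivative[OF matrix_vector_mul_bounded_linear u'])
    from bounded_bilinear.has_vector_derivative[OF bounded_bilinear_inner u' this]
    have "((\<lambda>s. u i s \<bullet> (?G *v u i s)) has_real_derivative
        u i t \<bullet> (?G *v u') + u' \<bullet> (?G *v u i t)) (at t within T)"
      by (simp add: has_real_derivative_iff_has_vector_derivative)
    from DERIV_cmult[OF this, of "h i / 2"] show ?thesis
      unfolding val .
  qed
  \<comment> \<open>Right-end and left-end terms are separated; the latter are then shifted to the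
    preceding element, with which they share an interface.\<close>
  have "(\<Sum>i<N. d i) = (\<Sum>i<N. (b i)\<^sup>2 - 2 * (b i * r i)) - (\<Sum>i<N. (a i)\<^sup>2 - 2 * (a i * l i))"
    by (simp add: d_def algebra_simps flip: sum_subtractf)
  also have "(\<Sum>i<N. (a i)\<^sup>2 - 2 * (a i * l i))
      = (\<Sum>i<N. (a (Suc i mod N))\<^sup>2 - 2 * (a (Suc i mod N) * l (Suc i mod N)))"
    by (rule sum_Suc_mod[symmetric])
  also have "\<dots> = (\<Sum>i<N. (a (Suc i mod N))\<^sup>2 - 2 * (a (Suc i mod N) * r i))"
    by (intro sum.cong) (simp_all add: l_def r_def left_flux_Suc_mod)
  \<comment> \<open>At one interface, with \<open>b\<close> and \<open>a\<close> the left and right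
    states, the terms combine to \<open>(a - b) (2 r - (a + b))\<close>, and the flux has
    \<open>2 r - (a + b) = - 2 \<alpha> (a - b)\<close>.\<close>
  also have "(\<Sum>i<N. (b i)\<^sup>2 - 2 * (b i * r i)) - \<dots>
      = (\<Sum>i<N. - 2 * \<alpha> * (a (Suc i mod N) - b i)\<^sup>2)"
    unfolding sum_subtractf[symmetric]
    by (intro sum.cong)
      (simp_all add: r_def right_flux_def a_def b_def power2_eq_square field_simps)
  also have "\<dots> \<le> 0"
    using \<alpha> by (intro sum_nonpos) (simp add: mult_nonneg_nonneg)
  finally have "(\<Sum>i<N. d i) \<le> 0" .
  moreover have "((\<lambda>s. \<Sum>i<N. h i / 2 * (u i s \<bullet> (?G *v u i s))) has_real_derivative
      (\<Sum>i<N. d i)) (at t within T)"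
    by (intro DERIV_sum energy) simp
  ultimately show "\<exists>d\<le>0. ((\<lambda>s. \<Sum>i<N. h i / 2 * (u i s \<bullet> (?G *v u i s)))
      has_real_derivative d) (at t within T)"
    by blast
qed

section \<open>Symmetric correction functions\<close>

abbreviation poly_reflect :: "real poly \<Rightarrow> real poly" where
  "poly_reflect f \<equiv> pcompose f [:0, - 1:]"

lemma poly_poly_reflect: "poly (poly_reflect f) x = poly f (- x)"
  by (simp add: poly_pcompose)

lemma degree_poly_reflect: "degree (poly_reflect f) = degree f"
  by (simp add: degree_pcompose)

text \<open>\<open>\<sigma>\<close> sends the index of a node to that of its mirror image. It is
  injective, so both sides have the same nodal values.\<close>

lemma poly_lagrange_reflect:
  fixes z :: "'n::finite \<Rightarrow> real"
  assumes inj: "inj z" and \<sigma>: "\<And>i. z (\<sigma> i) = - z i"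
  shows "poly_reflect (lagrange z (\<sigma> j)) = lagrange z j"
proof (rule poly_eqI_nodes[OF inj])
  fix i
  have "\<sigma> i = \<sigma> j \<longleftrightarrow> i = j"
    using \<sigma> inj by (metis injD neg_equal_iff_equal)
  then show "poly (poly_reflect (lagrange z (\<sigma> j))) (z i) = poly (lagrange z j) (z i)"
    by (simp add: poly_poly_reflect poly_lagrange_node[OF inj] flip: \<sigma>)
qed (simp_all add: degree_poly_reflect degree_lagrange_less)

text \<open>Exactness makes each weight the integral of its Lagrange polynomial, and the integral
  over \<open>[-1, 1]\<close> is invariant under reflection.\<close>

lemma quadrature_weight_reflect:
  fixes z w :: "'n::finite \<Rightarrow> real"
  assumes inj: "inj z" and \<sigma>: "\<And>i. z (\<sigma> i) = - z i"
    and exact: "\<And>j. quadrature_exact z w (lagrange z j)"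
  shows "w (\<sigma> i) = w i"
proof -
  have w: "w j = integral {- 1..1} (poly (lagrange z j))" for j
    using exact[of j]
    by (simp add: quadrature_exact_def poly_lagrange_node[OF inj] if_distrib sum.delta cong: if_cong)
  have "w i = integral {- 1..1} (\<lambda>x. poly (lagrange z (\<sigma> i)) (- x))"
    by (simp add: w flip: poly_lagrange_reflect[of z \<sigma> i, OF inj \<sigma>] poly_poly_reflect)
  also have "\<dots> = w (\<sigma> i)"
    using Henstock_Kurzweil_Integration.integral_reflect_real[of 1 "- 1" "poly (lagrange z (\<sigma> i))"]
    by (simp add: w)
  finally show ?thesis ..
qed

section \<open>Reflection invariance of the form of \<open>K\<close>\<close>

lemma nodal_monom: "nodal z (monom c m) = c *\<^sub>R nodal z (monom 1 m)"
  by (simp add: vec_eq_iff poly_monom)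

text \<open>Skewness moves the two exponents towards each other with their sum fixed; once they are adjacent,
  symmetry of \<open>K\<close> makes the value equal to its own negative.\<close>

lemma skew_form_monom_odd:
  fixes z :: "'n::finite \<Rightarrow> real"
  assumes inj: "inj z"
    and K: "transpose K = K" "transpose (K ** deriv_mat z) = - (K ** deriv_mat z)"
    and "m + 2 * d + 1 < CARD('n)"
  shows "nodal z (monom 1 m) \<bullet> (K *v nodal z (monom 1 (m + 2 * d + 1))) = 0"
  using assms(4)
proof (induction d arbitrary: m)
  case (0 m)
  have D: "deriv_mat z *v nodal z (monom 1 (Suc m)) = Suc m *\<^sub>R nodal z (monom 1 m)"
    using 0 by (simp add: deriv_mat_nodal[OF inj] degree_monom_eq pderiv_monom
        nodal_monom[of z "1 + real m"])
  have "nodal z (monom 1 m) \<bullet> (K *v nodal z (monom 1 (Suc m)))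
      = nodal z (monom 1 (Suc m)) \<bullet> (K *v nodal z (monom 1 m))"
    by (simp add: inner_symmetric_matrix[OF K(1), of "nodal z (monom 1 m)"] inner_commute)
  then show ?case
    using skew_form[OF K, of "nodal z (monom 1 (Suc m))" "nodal z (monom 1 (Suc m))"]
    by (simp add: D matrix_vector_mult_scaleR)
next
  case (Suc d m)
  \<comment> \<open>The claim concerns the exponents \<open>m\<close> and \<open>Suc ?n\<close>; the
    pair \<open>Suc m\<close>, \<open>?n\<close> has the same sum and is covered by the induction
    hypothesis.\<close>
  let ?n = "m + 2 * d + 2"
  have D: "deriv_mat z *v nodal z (monom 1 (Suc k)) = Suc k *\<^sub>R nodal z (monom 1 k)"
    if "Suc k < CARD('n)" for k
    using that by (simp add: deriv_mat_nodal[OF inj] degree_monom_eq pderiv_monom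
        nodal_monom[of z "1 + real k"])
  have "nodal z (monom 1 (Suc m)) \<bullet> (K *v nodal z (monom 1 ?n)) = 0"
    using Suc.IH[of "Suc m"] Suc.prems by simp
  then have "Suc m * (nodal z (monom 1 m) \<bullet> (K *v nodal z (monom 1 (Suc ?n)))) = 0"
    using skew_form[OF K, of "nodal z (monom 1 (Suc m))" "nodal z (monom 1 (Suc ?n))"] Suc.prems
      D[of m] D[of ?n]
    by (simp add: matrix_vector_mult_scaleR)
  then show ?case by simp
qed

text \<open>A bound \<open>n\<close> independent of the degree lets two polynomials be expanded over
  a common range.\<close>

lemma nodal_poly_sum:
  assumes "degree f < n"
  shows "nodal z f = (\<Sum>m<n. coeff f m *\<^sub>R nodal z (monom 1 m))"
    and "nodal z (poly_reflect f) = (\<Sum>m<n. ((- 1) ^ m * coeff f m) *\<^sub>R nodal z (monom 1 m))"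
proof -
  have "poly f x = (\<Sum>m<n. coeff f m * x ^ m)" for x
    unfolding poly_altdef
    by (rule sum.mono_neutral_left) (use assms in \<open>auto simp: coeff_eq_0\<close>)
  then show "nodal z f = (\<Sum>m<n. coeff f m *\<^sub>R nodal z (monom 1 m))"
    and "nodal z (poly_reflect f) = (\<Sum>m<n. ((- 1) ^ m * coeff f m) *\<^sub>R nodal z (monom 1 m))"
    by (simp_all add: vec_eq_iff poly_monom poly_poly_reflect power_minus[of "z _"] ac_simps)
qed

text \<open>In the monomial expansion reflection multiplies the \<open>(m, n)\<close> term by
  \<open>(-1)^(m + n)\<close>, and the terms that would change sign vanish.\<close>

lemma skew_form_reflect:
  fixes z :: "'n::finite \<Rightarrow> real"
  assumes inj: "inj z"
    and K: "transpose K = K" "transpose (K ** deriv_mat z) = - (K ** deriv_mat z)"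
    and deg: "degree f < CARD('n)" "degree g < CARD('n)"
  shows "nodal z (poly_reflect f) \<bullet> (K *v nodal z (poly_reflect g)) = nodal z f \<bullet> (K *v nodal z g)"
proof -
  define k where "k m n = nodal z (monom 1 m) \<bullet> (K *v nodal z (monom 1 n))" for m n
  have sym: "k m n = k n m" for m n
    by (simp add: k_def inner_symmetric_matrix[OF K(1), of "nodal z (monom 1 m)"] inner_commute)
  have odd_less: "k m n = 0" if "m < n" "n < CARD('n)" "odd (m + n)" for m n
  proof -
    obtain e where "n = m + Suc e"
      using less_imp_Suc_add[OF \<open>m < n\<close>] by auto
    moreover from this have "even e" using \<open>odd (m + n)\<close> by (metis add.assoc even_Suc even_add add_Suc_right)
    ultimately obtain d where "n = m + 2 * d + 1"
      by (auto elim: evenE)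
    then show ?thesis
      using skew_form_monom_odd[OF inj K, of m d] that by (simp add: k_def)
  qed
  have parity: "(- 1) ^ (m + n) * k m n = k m n" if "m < CARD('n)" "n < CARD('n)" for m n
  proof (cases "even (m + n)")
    case False
    then have "m < n \<or> n < m" by (cases m n rule: linorder_cases) auto
    then have "k m n = 0"
      using odd_less[of m n] odd_less[of n m] sym[of m n] that False by (auto simp: add.commute)
    then show ?thesis by simp
  qed simp
  have bil: "(\<Sum>m<CARD('n). x m *\<^sub>R nodal z (monom 1 m)) \<bullet>
      (K *v (\<Sum>n<CARD('n). y n *\<^sub>R nodal z (monom 1 n)))
      = (\<Sum>m<CARD('n). \<Sum>n<CARD('n). x m * y n * k m n)" for x y
    by (subst sum.swap)
      (simp add: linear_sum[OF matrix_vector_mul_linear] matrix_vector_mult_scaleR inner_sum_left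
        inner_sum_right k_def sum_distrib_left ac_simps)
  have "x m * y n * k m n = ((- 1) ^ m * x m) * ((- 1) ^ n * y n) * k m n"
    if "m < CARD('n)" "n < CARD('n)" for x y m n
    by (subst parity[OF that, symmetric]) (simp add: power_add)
  then show ?thesis
    unfolding nodal_poly_sum[OF deg(1)] nodal_poly_sum[OF deg(2)] bil
    by (intro sum.cong) auto
qed

text \<open>The nodal vectors of the Lagrange basis are the unit vectors, so the entries of
  \<open>K\<close> are the values of its form on a basis that reflection permutes.\<close>

lemma skew_matrix_reflect:
  fixes z :: "'n::finite \<Rightarrow> real"
  assumes inj: "inj z" and \<sigma>: "\<And>i. z (\<sigma> i) = - z i"
    and K: "transpose K = K" "transpose (K ** deriv_mat z) = - (K ** deriv_mat z)"
  shows "K $ \<sigma> i $ \<sigma> j = K $ i $ j"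
proof -
  have axis: "nodal z (lagrange z j) = axis j 1" for j
    by (simp add: vec_eq_iff poly_lagrange_node[OF inj] axis_def)
  have "K $ i $ j = nodal z (lagrange z i) \<bullet> (K *v nodal z (lagrange z j))" for i j
    by (simp add: axis inner_axis' matrix_vector_mult_basis column_def)
  then show ?thesis
    using skew_form_reflect[where f = "lagrange z (\<sigma> i)" and g = "lagrange z (\<sigma> j)", OF inj K]
    by (simp add: poly_lagrange_reflect[OF inj \<sigma>] degree_lagrange_less)
qed

section \<open>Correction functions: existence, uniqueness and symmetry\<close>

lemma antiderivative_exists:
  fixes q :: "real poly"
  shows "\<exists>g. pderiv g = q \<and> degree g \<le> Suc (degree q)"
proof (intro exI conjI)
  let ?g = "\<Sum>n\<le>degree q. monom (coeff q n / Suc n) (Suc n)"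
  show "pderiv ?g = q"
    by (simp add: pderiv_sum_finite pderiv_monom poly_as_sum_of_monoms del: of_nat_Suc)
  show "degree ?g \<le> Suc (degree q)"
    by (intro degree_sum_le) (auto intro: order_trans[OF degree_monom_le])
qed

text \<open>The nodal values fix the derivative, of degree below \<open>CARD('n)\<close>; the value
  at \<open>x\<close> fixes the constant of integration.\<close>

lemma primitive_ex1:
  fixes z :: "'n::finite \<Rightarrow> real"
  assumes inj: "inj z"
  shows "\<exists>!g. degree g \<le> CARD('n) \<and> (\<forall>i. poly (pderiv g) (z i) = c i) \<and> poly g x = y"
proof -
  define q where "q = (\<Sum>j\<in>UNIV. smult (c j) (lagrange z j))"
  have q: "degree q < CARD('n)" "\<And>i. poly q (z i) = c i"
    unfolding q_def using degree_lagrange_sum poly_lagrange_sum[OF inj] by blast+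
  obtain g where g: "pderiv g = q" "degree g \<le> Suc (degree q)"
    using antiderivative_exists by blast
  show ?thesis
  proof (rule ex1I)
    have "degree (g + [:y - poly g x:]) \<le> max (degree g) 0"
      by (rule order_trans[OF degree_add_le_max]) simp
    then show "degree (g + [:y - poly g x:]) \<le> CARD('n)
        \<and> (\<forall>i. poly (pderiv (g + [:y - poly g x:])) (z i) = c i)
        \<and> poly (g + [:y - poly g x:]) x = y"
      using q g by (simp add: pderiv_add pderiv_pCons)
  next
    fix g' assume g': "degree g' \<le> CARD('n) \<and> (\<forall>i. poly (pderiv g') (z i) = c i) \<and> poly g' x = y"
    have "degree (pderiv g') < CARD('n)"
      \<comment> \<open>\<open>degree_pderiv\<close> subtracts 1 with truncation, so a constant
        \<open>g'\<close> requires \<open>CARD('n) > 0\<close>.\<close>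
      using g' zero_less_card_finite[where 'a = 'n] unfolding degree_pderiv by linarith
    then have "pderiv g' = q"
      using g' q by (intro poly_eqI_nodes[OF inj]) auto
    then have "pderiv (g' - g) = 0"
      by (simp add: pderiv_diff g)
    then obtain e where e: "g' - g = [:e:]"
      using pderiv_iszero by blast
    then have "e = y - poly g x"
      using g' poly_diff[of g' g x] unfolding e by simp
    then show "g' = g + [:y - poly g x:]"
      using e by (simp add: algebra_simps)
  qed
qed

text \<open>The reflected right correction function is a left one, the chain rule supplying the sign
  in the condition on \<open>C\<close>; uniqueness then identifies them.\<close>

lemma symmetric_FRI:
  fixes z :: "'n::finite \<Rightarrow> real"
  assumes inj: "inj z" and \<sigma>: "\<And>i. z (\<sigma> i) = - z i"
    and C: "\<And>i. C $ i $ 1 = - (C $ \<sigma> i $ 2)"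
  shows "symmetric_FR z C"
proof -
  have left: "\<exists>!g. left_correction z C g" and right: "\<exists>!g. right_correction z C g"
    unfolding left_correction_def right_correction_def by (rule primitive_ex1[OF inj])+
  have "poly gL \<xi> = poly gR (- \<xi>)" if "left_correction z C gL" and R: "right_correction z C gR"
    for gL gR \<xi>
  proof -
    have "left_correction z C (poly_reflect gR)"
      using R unfolding left_correction_def right_correction_def
      by (simp add: degree_poly_reflect pderiv_pcompose poly_poly_reflect pderiv_pCons C flip: \<sigma>)
    then have "gL = poly_reflect gR"
      using left that by blast
    then show ?thesis by (simp add: poly_poly_reflect)
  qed
  then show ?thesis
    using left right unfolding symmetric_FR_def by blast
qed

lemma correction_reflect:
  fixes z :: "'n::finite \<Rightarrow> real"
  assumes inj: "inj z" and \<sigma>: "\<And>i. z (\<sigma> i) = - z i"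
    and G: "pos_definite G" "\<And>i j. G $ \<sigma> i $ \<sigma> j = G $ i $ j"
    and C: "G ** C = transpose (restr_mat z) ** bdry_mat"
  shows "C $ i $ 1 = - (C $ \<sigma> i $ 2)"
proof -
  have "\<sigma> (\<sigma> i) = i" for i
    using \<sigma> inj by (metis injD minus_minus)
  then have bij: "bij \<sigma>"
    by (rule involuntory_imp_bij)
  have entry: "(\<Sum>j\<in>UNIV. G $ i $ j * C $ j $ c) =
      poly (lagrange z i) (if c = 1 then - 1 else 1) * (if c = 1 then - 1 else 1)" for i c
  proof -
    have "(\<Sum>j\<in>UNIV. G $ i $ j * C $ j $ c) = (transpose (restr_mat z) ** bdry_mat) $ i $ c"
      by (subst C[symmetric]) (simp add: matrix_matrix_mult_def)
    also have "\<dots> = poly (lagrange z i) (if c = 1 then - 1 else 1) * (if c = 1 then - 1 else 1)"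
      using exhaust_2[of c]
      by (auto simp: matrix_matrix_mult_def transpose_def restr_mat_def bdry_mat_def sum_2)
    finally show ?thesis .
  qed
  \<comment> \<open>Reflection exchanges the end points, where \<open>B\<close> has opposite signs,
    so column 1 and the reflected column 2 have opposite images under \<open>G\<close>.\<close>
  have "G *v (\<chi> j. C $ j $ 1 + C $ \<sigma> j $ 2) = 0"
  proof -
    have "(\<Sum>j\<in>UNIV. G $ i $ j * C $ \<sigma> j $ 2) = (\<Sum>j\<in>UNIV. G $ \<sigma> i $ j * C $ j $ 2)" for i
      by (subst sum.reindex_bij_betw[OF bij, symmetric]) (simp add: G(2))
    moreover have "poly (lagrange z (\<sigma> i)) 1 = poly (lagrange z i) (- 1)" for i
      by (simp add: poly_poly_reflect flip: poly_lagrange_reflect[of z \<sigma> i, OF inj \<sigma>])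
    ultimately show ?thesis
      by (simp add: vec_eq_iff matrix_vector_mult_def distrib_left sum.distrib entry)
  qed
  then have "(\<chi> j. C $ j $ 1 + C $ \<sigma> j $ 2) = 0"
    by (rule pos_definite_ker[OF G(1)])
  then show ?thesis
    by (simp add: vec_eq_iff eq_neg_iff_add_eq_0)
qed


theorem theorem5:
  fixes p :: nat
    and z w :: "'n::{finite,linorder} \<Rightarrow> real"
    and C :: "real ^ 2 ^ 'n::{finite,linorder}"
  assumes card: "CARD('n) = p + 1"
    and nodes_less: "strict_mono z"
    and nodes_interval: "\<And>i. z i \<in> {- 1..1}"
    and nodes_symmetric: "uminus ` range z = range z"
    and weights_pos: "\<And>i. w i > 0"
    and exact: "\<And>q. degree q < 2 * p \<Longrightarrow> quadrature_exact z w q"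
    and SBP: "mass_mat w ** deriv_mat z + transpose (deriv_mat z) ** mass_mat w
      = transpose (restr_mat z) ** bdry_mat ** restr_mat z"
  shows "(1 v* (mass_mat w ** C) = 1 v* (transpose (restr_mat z) ** bdry_mat)
            \<longrightarrow> cpr_conservative z w C)
    \<and> (\<forall>K :: real ^ 'n::{finite,linorder} ^ 'n::{finite,linorder}.
          transpose K = K \<and> pos_definite (mass_mat w + K)
          \<and> transpose (K ** deriv_mat z) = - (K ** deriv_mat z)
          \<and> C = matrix_inv (mass_mat w + K) ** transpose (restr_mat z) ** bdry_mat
            \<longrightarrow> cpr_linearly_stable z C (mass_mat w + K))
    \<and> (\<forall>K :: real ^ 'n::{finite,linorder} ^ 'n::{finite,linorder}.
          transpose K = K \<and> pos_definite (mass_mat w + K)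
          \<and> transpose (K ** deriv_mat z) = - (K ** deriv_mat z)
          \<and> C = matrix_inv (mass_mat w + K) ** transpose (restr_mat z) ** bdry_mat
            \<longrightarrow> symmetric_FR z C)"
proof (intro conjI allI impI; (elim conjE)?)
  have inj: "inj z"
    using nodes_less by (rule strict_mono_imp_inj_on)
  show "cpr_conservative z w C"
    if "1 v* (mass_mat w ** C) = 1 v* (transpose (restr_mat z) ** bdry_mat)"
    by (rule cpr_conservativeI[OF inj SBP that])
  fix K :: "real ^ 'n::{finite,linorder} ^ 'n::{finite,linorder}"
  assume K: "transpose K = K" "transpose (K ** deriv_mat z) = - (K ** deriv_mat z)"
    and pos: "pos_definite (mass_mat w + K)"
    and "C = matrix_inv (mass_mat w + K) ** transpose (restr_mat z) ** bdry_mat"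
  then have C: "(mass_mat w + K) ** C = transpose (restr_mat z) ** bdry_mat"
    using pos_definite_mult_correction by blast
  show "cpr_linearly_stable z C (mass_mat w + K)"
    by (rule cpr_linearly_stableI[OF SBP K C])
  have "\<forall>i. \<exists>j. z j = - z i"
    using nodes_symmetric by (metis imageE image_eqI rangeI)
  then obtain \<sigma> where \<sigma>: "\<And>i. z (\<sigma> i) = - z i"
    by metis
  \<comment> \<open>For \<open>p = 0\<close> no polynomial satisfies
    \<open>degree q < 2 * p\<close>, but there is only one index. Otherwise \<open>p < 2 * p\<close>
    covers the Lagrange polynomials.\<close>
  have "w (\<sigma> i) = w i" for i
  proof (cases "p = 0")
    case True
    then have "\<sigma> i = i"
      using card card_1_singletonE[of "UNIV :: 'n::{finite,linorder} set"] by (metis UNIV_I add_0 singletonD)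
    then show ?thesis by simp
  next
    case False
    then have "degree (lagrange z j) < 2 * p" for j
      using degree_lagrange[of z j] card by simp
    then show ?thesis
      by (intro quadrature_weight_reflect[OF inj \<sigma>] exact)
  qed
  then have sym: "(mass_mat w + K) $ \<sigma> i $ \<sigma> j = (mass_mat w + K) $ i $ j" for i j
    using skew_matrix_reflect[OF inj \<sigma> K, of i j] \<sigma> inj
    by (auto simp: mass_mat_def) (metis injD neg_equal_iff_equal)+
  show "symmetric_FR z C"
    by (rule symmetric_FRI[OF inj \<sigma> correction_reflect[OF inj \<sigma> pos sym C]])
qed

end
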